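(* Let $G=(V,E)$ be a finite simple graph with $d$ vertices. Then $$A_G(V)=\sum_{\pi\in L_G}(-1)^{d-|\pi|}\mu_G(\hat{0},\pi)\prod_{B\in\pi}v_B .$$
   Context: An orientation of $G$ assigns a direction to each edge; it is acyclic if it has no directed cycles. $\mathcal{A}(G)$ is the set of acyclic orientations of $G$. For $\mathfrak{o}\in\mathcal{A}(G)$, a vertex $v$ is a sink if every edge incident with $v$ is directed toward $v$ (in particular, isolated vertices are sinks); $\operatorname{Sink}(\mathfrak{o})$ is the set of sinks of $\mathfrak{o}$. To each vertex $v\in V$ associate a commuting variable, also denoted $v$, and let $\mathbb{Z}[V]$ be the polynomial ring in these variables. The acyclic orientation polynomial of $G$ is $$A_G(V)=\sum_{\mathfrak{o}\in\mathcal{A}(G)}\ \prod_{v\in\operatorname{Sink}(\mathfrak{o})}v\ \in\mathbb{Z}[V].$$ A vertex partition $\pi$ is a set of mutually disjoint non-empty subsets of $V$ (called blocks) whose union is $V$; $|\pi|$ is its number of blocks. A bond is a vertex partition each of whose blocks induces a connected subgraph of $G$. $L_G$ is the set of bonds of $G$, partially ordered by refinement (the bond lattice); its least element $\hat{0}$ is the bond all of whose blocks are singletons. $\mu_G$ is the M\"obius function of the poset $L_G$: $\mu_G(\sigma,\sigma)=1$, $\mu_G(\sigma,\pi)=-\sum_{\sigma\le\tau<\pi}\mu_G(\sigma,\tau)$ if $\sigma<\pi$, and $\mu_G(\sigma,\pi)=0$ otherwise. For a block $B\subseteq V$, put $$v_B=1-\prod_{v\in B}(1-v)\in\mathbb{Z}[V].$$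 *)

theory Defs
  imports Graph_Theory.Graph_Theory "HOL-Library.Disjoint_Sets" "HOL-Library.Poly_Mapping"
begin

text \<open>
  A finite simple graph is a value \<open>G\<close> with \<open>pair_graph G\<close>: a finite vertex set \<open>pverts G\<close> and a
  symmetric, irreflexive set \<open>parcs G\<close> of pairs, in which an edge \<open>uv\<close> is represented by the two
  pairs \<open>(u, v)\<close> and \<open>(v, u)\<close>.
\<close>

section \<open>Acyclic orientations and sinks\<close>

definition orientations :: "'v pair_pre_digraph \<Rightarrow> 'v pair_pre_digraph set" where
  "orientations G = {D. pverts D = pverts G \<and> parcs D \<subseteq> parcs G \<and>
     (\<forall>(u, v) \<in> parcs G. (u, v) \<in> parcs D \<longleftrightarrow> (v, u) \<notin> parcs D)}"

definition acyclic_orientations :: "'v pair_pre_digraph \<Rightarrow> 'v pair_pre_digraph set" where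
  "acyclic_orientations G = {D \<in> orientations G. \<nexists>p. pre_digraph.cycle (with_proj D) p}"

definition sinks :: "'v pair_pre_digraph \<Rightarrow> 'v set" where
  "sinks D = {v \<in> pverts D. \<forall>e \<in> parcs D. fst e = v \<or> snd e = v \<longrightarrow> snd e = v}"

lemma finite_acyclic_orientations:
  assumes "pair_graph G"
  shows "finite (acyclic_orientations G)"
proof -
  interpret pair_graph G by fact
  have "acyclic_orientations G \<subseteq>
      (\<lambda>A. \<lparr>pverts = pverts G, parcs = A\<rparr>) ` Pow (parcs G)"
  proof
    fix D assume "D \<in> acyclic_orientations G"
    then show "D \<in> (\<lambda>A. \<lparr>pverts = pverts G, parcs = A\<rparr>) ` Pow (parcs G)"
      by (cases D) (auto simp: acyclic_orientations_def orientations_def)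
  qed
  then show ?thesis
    using pair_finite_arcs by (meson finite_Pow_iff finite_imageI finite_subset)
qed


section \<open>The polynomial ring\<close>

text \<open>
  Integer polynomials with one variable for each element of the type \<open>'v\<close>, as finitely supported
  coefficient functions on exponent vectors. For a graph with vertex set \<open>V\<close> of elements of \<open>'v\<close>,
  the ring \<open>\<int>[V]\<close> is the subring in which only the variables from \<open>V\<close> occur.
\<close>

type_synonym 'v int_mpoly = "('v \<Rightarrow>\<^sub>0 nat) \<Rightarrow>\<^sub>0 int"

definition Var :: "'v \<Rightarrow> 'v int_mpoly" where
  "Var v = Poly_Mapping.single (Poly_Mapping.single v 1) 1"

definition acyclic_orientation_poly :: "'v pair_pre_digraph \<Rightarrow> 'v int_mpoly" where
  "acyclic_orientation_poly G = (\<Sum>D \<in> acyclic_orientations G. \<Prod>v \<in> sinks D. Var v)"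

definition block_poly :: "'v set \<Rightarrow> 'v int_mpoly" where
  "block_poly B = 1 - (\<Prod>v \<in> B. 1 - Var v)"


section \<open>The bond lattice and its Moebius function\<close>

definition bonds :: "'v pair_pre_digraph \<Rightarrow> 'v set set set" where
  "bonds G = {P. partition_on (pverts G) P \<and>
     (\<forall>B \<in> P. Digraph_Component.connected (with_proj G \<restriction> B))}"

definition bot_bond :: "'v pair_pre_digraph \<Rightarrow> 'v set set" where
  "bot_bond G = (\<lambda>v. {v}) ` pverts G"

lemma finite_bonds: "finite (pverts G) \<Longrightarrow> finite (bonds G)"
  by (rule finite_subset[where B = "Pow (Pow (pverts G))"])
     (auto simp: bonds_def partition_on_def)

lemma bot_bond_in_bonds:
  assumes "pair_graph G"
  shows "bot_bond G \<in> bonds G"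
proof -
  have "Digraph_Component.connected (with_proj G \<restriction> {v})" for v
    by (auto simp: Digraph_Component.connected_def strongly_connected_def mk_symmetric_def
        reachable_def intro: rtrancl_on.intros)
  then show ?thesis
    by (auto simp: bonds_def bot_bond_def partition_on_def disjoint_def)
qed

lemma bot_bond_least:
  assumes "pair_graph G" "P \<in> bonds G"
  shows "refines (pverts G) (bot_bond G) P"
  using bot_bond_in_bonds[OF assms(1)] assms(2)
  by (auto simp: bonds_def refines_def bot_bond_def partition_on_def)

text \<open>
  The guard \<open>finite (pverts G)\<close> only serves to make the recursion terminate on every argument.
\<close>

function bond_moebius ::
  "'v pair_pre_digraph \<Rightarrow> 'v set set \<Rightarrow> 'v set set \<Rightarrow> int" where
  "bond_moebius G \<sigma> \<pi> =
    (if finite (pverts G) \<and> \<sigma> \<in> bonds G \<and> \<pi> \<in> bonds G \<and> refines (pverts G) \<sigma> \<pi> then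
       if \<sigma> = \<pi> then 1
       else - (\<Sum>\<tau> \<in> {\<tau> \<in> bonds G. refines (pverts G) \<sigma> \<tau> \<and>
                                     refines (pverts G) \<tau> \<pi> \<and> \<tau> \<noteq> \<pi>}. bond_moebius G \<sigma> \<tau>)
     else 0)"
  by pat_completeness auto
termination
proof (relation "measure (\<lambda>(G, \<sigma>, \<pi>). card {\<rho> \<in> bonds G. refines (pverts G) \<rho> \<pi>})")
  fix G :: "'v pair_pre_digraph" and \<sigma> \<pi> \<tau>
  assume A: "finite (pverts G) \<and> \<sigma> \<in> bonds G \<and> \<pi> \<in> bonds G \<and> refines (pverts G) \<sigma> \<pi>"
    and T: "\<tau> \<in> {\<tau> \<in> bonds G. refines (pverts G) \<sigma> \<tau> \<and> refines (pverts G) \<tau> \<pi> \<and> \<tau> \<noteq> \<pi>}"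
  have "\<pi> \<in> {\<rho> \<in> bonds G. refines (pverts G) \<rho> \<pi>}"
    using A by (auto simp: bonds_def intro: refines_refl)
  moreover have "\<pi> \<notin> {\<rho> \<in> bonds G. refines (pverts G) \<rho> \<tau>}"
    using T refines_asym by blast
  moreover have "{\<rho> \<in> bonds G. refines (pverts G) \<rho> \<tau>} \<subseteq>
      {\<rho> \<in> bonds G. refines (pverts G) \<rho> \<pi>}"
    using T refines_trans by blast
  ultimately have "{\<rho> \<in> bonds G. refines (pverts G) \<rho> \<tau>} \<subset>
      {\<rho> \<in> bonds G. refines (pverts G) \<rho> \<pi>}"
    by blast
  then have "card {\<rho> \<in> bonds G. refines (pverts G) \<rho> \<tau>} <
      card {\<rho> \<in> bonds G. refines (pverts G) \<rho> \<pi>}"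
    using A by (intro psubset_card_mono) (simp_all add: finite_bonds)
  then show "((G, \<sigma>, \<tau>), (G, \<sigma>, \<pi>)) \<in>
      measure (\<lambda>(G, \<sigma>, \<pi>). card {\<rho> \<in> bonds G. refines (pverts G) \<rho> \<pi>})"
    by simp
qed simp

declare bond_moebius.simps [simp del]

lemma bond_moebius_refl:
  assumes "pair_graph G" "\<sigma> \<in> bonds G"
  shows "bond_moebius G \<sigma> \<sigma> = 1"
proof -
  interpret pair_graph G by fact
  show ?thesis
    using assms(2) pair_finite_verts
    by (subst bond_moebius.simps) (auto simp: bonds_def intro: refines_refl)
qed

lemma bond_moebius_less:
  assumes "pair_graph G" "\<sigma> \<in> bonds G" "\<pi> \<in> bonds G" "refines (pverts G) \<sigma> \<pi>" "\<sigma> \<noteq> \<pi>"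
  shows "bond_moebius G \<sigma> \<pi> =
    - (\<Sum>\<tau> \<in> {\<tau> \<in> bonds G. refines (pverts G) \<sigma> \<tau> \<and> refines (pverts G) \<tau> \<pi> \<and> \<tau> \<noteq> \<pi>}.
        bond_moebius G \<sigma> \<tau>)"
proof -
  interpret pair_graph G by fact
  show ?thesis
    using assms pair_finite_verts by (subst bond_moebius.simps) simp
qed

lemma bond_moebius_not_le:
  "\<not> refines (pverts G) \<sigma> \<pi> \<Longrightarrow> bond_moebius G \<sigma> \<pi> = 0"
  by (subst bond_moebius.simps) simp

end

theory Submission
  imports Defs
begin

text \<open>
  By Whitney's formula, \<open>\<mu>(0, \<pi>)\<close> is the sum of \<open>(-1)^|F|\<close> over the edge sets \<open>F\<close> whose components
  are the blocks of \<open>\<pi>\<close>, so the right-hand side is a sum over all edge sets. In the variables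
  \<open>x = 1 - v\<close>, both sides then expand as the sum of \<open>(-1)^|S| h(V - S) x^S\<close> over the independent sets
  \<open>S\<close>: on the left, because making \<open>S\<close> a set of sinks leaves an arbitrary acyclic orientation of
  \<open>G - S\<close>, and \<open>h(W)\<close> is the number of acyclic orientations of \<open>G[W]\<close>; on the right, because \<open>F\<close>
  splits into edges inside \<open>S\<close>, whose signs cancel unless \<open>S\<close> is independent, and edges outside \<open>S\<close>.
  At \<open>x = 1\<close> both sides vanish if \<open>V\<close> is non-empty (an acyclic orientation has a sink). This gives the
  same recursion for the two functions \<open>h\<close>, which therefore agree.
\<close>

section \<open>Connected components of edge sets\<close>

text \<open>Unordered pairs, because \<open>E\<close> holds both directions of an edge and the sign
  \<open>(-1) ^ card F\<close> must count it once.\<close>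

definition edges_in :: "'v rel \<Rightarrow> 'v set \<Rightarrow> 'v set set" where
  "edges_in E W = {{u, v} | u v. (u, v) \<in> E \<and> u \<in> W \<and> v \<in> W}"

definition linked :: "'v set set \<Rightarrow> 'v rel" where
  "linked F = {(u, v). {u, v} \<in> F}\<^sup>*"

text \<open>Isolated vertices form components too: \<open>linked F\<close> is reflexive on the whole
  type, and \<open>W\<close> selects the classes of its own vertices.\<close>

definition comps :: "'v set \<Rightarrow> 'v set set \<Rightarrow> 'v set set" where
  "comps W F = (\<lambda>v. linked F `` {v}) ` W"

lemma finite_edges_in: "finite W \<Longrightarrow> finite (edges_in E W)"
  by (rule finite_subset[of _ "Pow W"]) (auto simp: edges_in_def)

lemma edges_in_subset_Pow: "edges_in E W \<subseteq> Pow W"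
  by (auto simp: edges_in_def)

lemma edges_in_Int_Pow: "S \<subseteq> W \<Longrightarrow> edges_in E W \<inter> Pow S = edges_in E S"
  unfolding edges_in_def by blast

lemma empty_notin_edges_in: "{} \<notin> edges_in E W"
  by (auto simp: edges_in_def)

lemma equiv_linked: "equiv UNIV (linked F)"
proof (rule equivI)
  have "sym {(u, v). {u, v} \<in> F}"
    by (auto simp: sym_def insert_commute)
  then show "sym (linked F)"
    unfolding linked_def by (rule sym_rtrancl)
qed (auto simp: linked_def refl_rtrancl trans_rtrancl)

lemma linked_class_eq_iff: "linked F `` {u} = linked F `` {v} \<longleftrightarrow> (u, v) \<in> linked F"
  by (rule eq_equiv_class_iff[OF equiv_linked UNIV_I UNIV_I])

lemma linked_edge: "{u, v} \<in> F \<Longrightarrow> (u, v) \<in> linked F"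
  by (auto simp: linked_def)

lemma linked_mono: "F \<subseteq> F' \<Longrightarrow> linked F \<subseteq> linked F'"
  unfolding linked_def by (rule rtrancl_mono) auto

text \<open>An edge of \<open>F\<close> that meets \<open>S\<close> cannot lie in \<open>T\<close>,
  so it lies in \<open>S\<close>; a walk starting in \<open>S\<close> therefore never leaves
  it.\<close>

lemma linked_restrict:
  assumes "(u, v) \<in> linked F" "u \<in> S" "F \<subseteq> Pow S \<union> Pow T" "S \<inter> T = {}"
  shows "v \<in> S \<and> (u, v) \<in> linked (F \<inter> Pow S)"
  using assms(1) unfolding linked_def
proof (induction rule: rtrancl_induct)
  case base
  then show ?case using assms(2) by simp
next
  case (step y z)
  then have "{y, z} \<in> F" "y \<in> S" by auto
  then have "{y, z} \<subseteq> S" using assms(3,4) by blast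
  with step show ?case
    by (auto intro: rtrancl_into_rtrancl)
qed

lemma comps_restrict:
  assumes "F \<subseteq> Pow S \<union> Pow T" "S \<inter> T = {}"
  shows "comps S (F \<inter> Pow S) = comps S F"
proof -
  have "linked (F \<inter> Pow S) `` {v} = linked F `` {v}" if "v \<in> S" for v
    using linked_restrict[OF _ that assms] linked_mono[of "F \<inter> Pow S" F] by blast
  then show ?thesis
    by (simp add: comps_def)
qed

lemma partition_on_comps:
  assumes "F \<subseteq> Pow W"
  shows "partition_on W (comps W F)"
proof (rule partition_onI)
  have refl: "(v, v) \<in> linked F" for v by (simp add: linked_def)
  have "linked F `` {v} \<subseteq> W" if "v \<in> W" for v
    using linked_restrict[OF _ that, of _ F "{}"] assms by auto
  then show "\<Union> (comps W F) = W"
    using refl by (auto simp: comps_def)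
  show "{} \<notin> comps W F"
    using refl by (auto simp: comps_def)
  show "disjnt B B'" if "B \<in> comps W F" "B' \<in> comps W F" "B \<noteq> B'" for B B'
  proof -
    have "B \<in> UNIV // linked F" "B' \<in> UNIV // linked F"
      using that by (auto simp: comps_def quotient_def)
    then show ?thesis
      using quotient_disj[OF equiv_linked] that(3) by (auto simp: disjnt_def)
  qed
qed

text \<open>Each block is non-empty and so contributes at least 1 to the size of \<open>A\<close>.
  The bound makes the subtraction in \<open>d - card \<pi>\<close> a genuine one.\<close>

lemma card_partition_on_le:
  assumes "finite A" "partition_on A P"
  shows "card P \<le> card A"
proof -
  have "finite B" "B \<noteq> {}" if "B \<in> P" for B
    using that assms partition_onD1[OF assms(2)] partition_onD3[OF assms(2)]
    by (auto intro: finite_subset[of B A])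
  then have "1 \<le> card B" if "B \<in> P" for B
    using that by (simp add: Suc_le_eq card_gt_0_iff)
  then have "card P \<le> (\<Sum>B\<in>P. card B)"
    using sum_mono[of P "\<lambda>_. 1" card] by simp
  also have "\<dots> = card A"
    using product_partition[OF assms(2)] \<open>\<And>B. B \<in> P \<Longrightarrow> finite B\<close> by simp
  finally show ?thesis .
qed

lemma finite_comps: "finite W \<Longrightarrow> finite (comps W F)"
  by (simp add: comps_def)

lemma comps_split:
  assumes "F \<subseteq> Pow S \<union> Pow T" "S \<inter> T = {}"
  shows "comps (S \<union> T) F = comps S (F \<inter> Pow S) \<union> comps T (F \<inter> Pow T)"
  using comps_restrict[of F S T] comps_restrict[of F T S] assms
  by (simp add: Int_commute Un_commute) (auto simp: comps_def)

lemma card_comps_split: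
  assumes "F \<subseteq> Pow S \<union> Pow T" "S \<inter> T = {}" "finite S" "finite T"
  shows "card (comps (S \<union> T) F) = card (comps S (F \<inter> Pow S)) + card (comps T (F \<inter> Pow T))"
proof -
  have S: "partition_on S (comps S (F \<inter> Pow S))" and T: "partition_on T (comps T (F \<inter> Pow T))"
    by (simp_all add: partition_on_comps)
  have "comps S (F \<inter> Pow S) \<inter> comps T (F \<inter> Pow T) = {}"
  proof (rule equals0I)
    fix B assume B: "B \<in> comps S (F \<inter> Pow S) \<inter> comps T (F \<inter> Pow T)"
    then have "B \<subseteq> S" "B \<subseteq> T"
      by (subst partition_onD1[OF S] partition_onD1[OF T]; blast)+
    moreover have "B \<noteq> {}" using B partition_onD3[OF S] by auto
    ultimately show False using assms(2) by blast
  qed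
  then show ?thesis
    using assms by (simp add: comps_split card_Un_disjoint finite_comps)
qed

section \<open>Expansion over independent sets\<close>

text \<open>The sum expands the product of \<open>1 - 1\<close> over \<open>A\<close>. It cancels
  edge sets inside \<open>S\<close>, and later those inside the blocks of a bond.\<close>

lemma sum_Pow_minus_one:
  assumes "finite A"
  shows "(\<Sum>X\<in>Pow A. (-1) ^ card X) = (if A = {} then 1 else 0 :: 'a :: comm_ring_1)"
  using prod_diff_conv_sum[OF assms, of "\<lambda>_. 1" "\<lambda>_. 1 :: 'a"] assms
  by (auto simp: power_0_left card_gt_0_iff)

text \<open>Multiplying out picks a set \<open>T\<close> of components, which is encoded by its
  union \<open>S\<close>: a subset of \<open>W\<close> is a union of components exactly when no edge
  of \<open>F\<close> joins it to its complement.\<close>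

lemma prod_comps_expand:
  fixes x :: "'v \<Rightarrow> 'a :: comm_ring_1"
  assumes "finite W" "F \<subseteq> edges_in E W"
  shows "(\<Prod>B\<in>comps W F. 1 - (\<Prod>v\<in>B. x v)) =
    (\<Sum>S | S \<in> Pow W \<and> F \<subseteq> Pow S \<union> Pow (W - S).
       (-1) ^ card (comps S (F \<inter> Pow S)) * (\<Prod>v\<in>S. x v))"
proof -
  have FW: "F \<subseteq> Pow W" using assms(2) edges_in_subset_Pow by blast
  note part = partition_on_comps[OF FW]
  have fin: "finite (comps W F)" by (simp add: assms(1) finite_comps)
  have un: "comps (\<Union>T) (F \<inter> Pow (\<Union>T)) = T \<and> F \<subseteq> Pow (\<Union>T) \<union> Pow (W - \<Union>T)"
    if T: "T \<subseteq> comps W F" for T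
  proof -
    \<comment> \<open>Components that share a vertex coincide.\<close>
    have cls: "linked F `` {u} \<in> T" if "u \<in> \<Union>T" for u
    proof -
      from that obtain v where "linked F `` {v} \<in> T" "(v, u) \<in> linked F"
        using T by (auto simp: comps_def)
      then show ?thesis using linked_class_eq_iff[of F v u] by simp
    qed
    have sep: "F \<subseteq> Pow (\<Union>T) \<union> Pow (W - \<Union>T)"
    proof
      fix e assume e: "e \<in> F"
      with assms(2) obtain u v where uv: "e = {u, v}" by (auto simp: edges_in_def)
      then have "(u, v) \<in> linked F" "(v, u) \<in> linked F"
        using e by (auto intro!: linked_edge simp: insert_commute)
      then have "u \<in> \<Union>T \<longleftrightarrow> v \<in> \<Union>T"
        using cls by blast
      then show "e \<in> Pow (\<Union>T) \<union> Pow (W - \<Union>T)"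
        using uv FW e by auto
    qed
    have "comps (\<Union>T) F = T"
    proof
      show "comps (\<Union>T) F \<subseteq> T" using cls by (auto simp: comps_def)
      show "T \<subseteq> comps (\<Union>T) F"
      proof
        fix B assume B: "B \<in> T"
        with T obtain v where v: "B = linked F `` {v}" by (auto simp: comps_def)
        then have "v \<in> B" by (simp add: linked_def)
        then show "B \<in> comps (\<Union>T) F" using v B by (auto simp: comps_def)
      qed
    qed
    then show ?thesis using comps_restrict[OF sep] sep by auto
  qed
  have prod: "(\<Prod>B\<in>T. \<Prod>v\<in>B. x v) = (\<Prod>v\<in>\<Union>T. x v)" if "T \<subseteq> comps W F" for T
  proof (rule prod.Union_disjoint[symmetric, unfolded comp_def])
    have "\<Union>(comps W F) = W" using part by (simp add: partition_on_def)
    then have "A \<subseteq> W" if "A \<in> T" for A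
      using that \<open>T \<subseteq> comps W F\<close> by blast
    then show "\<forall>A\<in>T. finite A"
      using assms(1) finite_subset by blast
    show "\<forall>A\<in>T. \<forall>B\<in>T. A \<noteq> B \<longrightarrow> A \<inter> B = {}"
      using that partition_onD2[OF part] unfolding disjoint_def by blast
  qed
  have "(\<Prod>B\<in>comps W F. 1 - (\<Prod>v\<in>B. x v)) =
      (\<Sum>T\<in>Pow (comps W F). (-1) ^ card T * (\<Prod>B\<in>T. \<Prod>v\<in>B. x v))"
    by (subst prod_diff_conv_sum[OF fin]) simp
  also have "\<dots> = (\<Sum>S | S \<in> Pow W \<and> F \<subseteq> Pow S \<union> Pow (W - S).
       (-1) ^ card (comps S (F \<inter> Pow S)) * (\<Prod>v\<in>S. x v))"
  proof (rule sum.reindex_bij_witness[where j = Union and i = "\<lambda>S. comps S (F \<inter> Pow S)"])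
    fix T assume T: "T \<in> Pow (comps W F)"
    then show "comps (\<Union>T) (F \<inter> Pow (\<Union>T)) = T" using un by simp
    show "\<Union>T \<in> {S. S \<in> Pow W \<and> F \<subseteq> Pow S \<union> Pow (W - S)}"
      using T un[of T] partition_onD1[OF part] by blast
    show "(-1) ^ card (comps (\<Union>T) (F \<inter> Pow (\<Union>T))) * (\<Prod>v\<in>\<Union>T. x v) =
        (-1) ^ card T * (\<Prod>B\<in>T. \<Prod>v\<in>B. x v)"
      using T un[of T] prod[of T] by simp
  next
    fix S assume S: "S \<in> {S. S \<in> Pow W \<and> F \<subseteq> Pow S \<union> Pow (W - S)}"
    then have "comps W F = comps S (F \<inter> Pow S) \<union> comps (W - S) (F \<inter> Pow (W - S))"
      using comps_split[of F S "W - S"] by (simp add: Un_absorb1)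
    then show "comps S (F \<inter> Pow S) \<in> Pow (comps W F)" by auto
    show "\<Union>(comps S (F \<inter> Pow S)) = S"
      using partition_on_comps[of "F \<inter> Pow S" S] by (simp add: partition_on_def)
  qed
  finally show ?thesis .
qed

text \<open>For a graph this is \<open>(-1) ^ card W\<close> times the chromatic polynomial of the
  subgraph induced on \<open>W\<close>, evaluated at -1 through its expansion over edge
  sets.\<close>

definition edge_set_sum :: "'v rel \<Rightarrow> 'v set \<Rightarrow> int" where
  "edge_set_sum E W = (\<Sum>F\<in>Pow (edges_in E W). (-1) ^ (card F + card W + card (comps W F)))"

text \<open>The common form of both sides. The ring is left open because \<open>x v\<close> is
  \<open>1 - Var v\<close> in the theorem and the integer 1 in the recursion for
  \<open>h\<close>.\<close>

definition independent_sum :: "'v rel \<Rightarrow> ('v set \<Rightarrow> int) \<Rightarrow> 'v set \<Rightarrow> ('v \<Rightarrow> 'a) \<Rightarrow> 'a :: comm_ring_1" where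
  "independent_sum E h W x = (\<Sum>S | S \<in> Pow W \<and> edges_in E S = {}.
     (-1) ^ card S * of_int (h (W - S)) * (\<Prod>v\<in>S. x v))"

text \<open>\<open>F\<close> is a free choice of edges inside \<open>S\<close> and edges inside
  \<open>W - S\<close>. The components in \<open>S\<close> are counted twice, so their sign cancels
  and the choice inside \<open>S\<close> contributes a bare alternating sum.\<close>

lemma sum_separated:
  fixes c :: "'a :: comm_ring_1"
  assumes "finite W" "S \<subseteq> W"
  shows "(\<Sum>F | F \<in> Pow (edges_in E W) \<and> F \<subseteq> Pow S \<union> Pow (W - S).
      (-1) ^ (card F + card W + card (comps W F) + card (comps S (F \<inter> Pow S)))) =
    (if edges_in E S = {} then (-1) ^ card S * of_int (edge_set_sum E (W - S)) else 0 :: 'a)"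
proof -
  let ?T = "W - S"
  have fin: "finite S" "finite ?T"
    using assms finite_subset by auto
  \<comment> \<open>The only overlap of the two power sets is the empty set, which is not an edge;
    so the two parts of \<open>F\<close> are disjoint.\<close>
  have PowT: "Pow S \<inter> Pow ?T = {{}}" by auto
  have "(\<Sum>F | F \<in> Pow (edges_in E W) \<and> F \<subseteq> Pow S \<union> Pow ?T.
      (-1) ^ (card F + card W + card (comps W F) + card (comps S (F \<inter> Pow S)))) =
    (\<Sum>(F1, F2)\<in>Pow (edges_in E S) \<times> Pow (edges_in E ?T).
      (-1) ^ card F1 * ((-1) ^ card S * (-1) ^ (card F2 + card ?T + card (comps ?T F2))) :: 'a)"
  proof (rule sum.reindex_bij_witness[where
        j = "\<lambda>F. (F \<inter> Pow S, F \<inter> Pow ?T)" and i = "\<lambda>(F1, F2). F1 \<union> F2"])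
    fix F assume F: "F \<in> {F. F \<in> Pow (edges_in E W) \<and> F \<subseteq> Pow S \<union> Pow ?T}"
    then show "(case (F \<inter> Pow S, F \<inter> Pow ?T) of (F1, F2) \<Rightarrow> F1 \<union> F2) = F" by auto
    show "(F \<inter> Pow S, F \<inter> Pow ?T) \<in> Pow (edges_in E S) \<times> Pow (edges_in E ?T)"
      using F Int_mono[of F "edges_in E W" "Pow S" "Pow S"] edges_in_Int_Pow[OF assms(2), of E]
        Int_mono[of F "edges_in E W" "Pow ?T" "Pow ?T"] edges_in_Int_Pow[of ?T W E]
      by simp
    have W: "W = S \<union> ?T" using assms(2) by auto
    have FE: "F \<subseteq> edges_in E W" using F by simp
    then have finF: "finite F" using finite_edges_in[OF assms(1)] by (rule finite_subset)
    from FE have "{} \<notin> F" by (rule contra_subsetD) (rule empty_notin_edges_in)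
    moreover have "(F \<inter> Pow S) \<inter> (F \<inter> Pow ?T) = F \<inter> (Pow S \<inter> Pow ?T)" by (simp only: Int_ac)
    ultimately have disj: "(F \<inter> Pow S) \<inter> (F \<inter> Pow ?T) = {}" unfolding PowT by simp
    have "F = (F \<inter> Pow S) \<union> (F \<inter> Pow ?T)" using F by auto
    then have cF: "card F = card (F \<inter> Pow S) + card (F \<inter> Pow ?T)"
      using card_Un_disjoint[OF _ _ disj] finF by (metis finite_Int)
    have cW: "card W = card S + card ?T"
      using fin assms by (metis W card_Un_disjoint Diff_disjoint)
    have cc: "card (comps W F) = card (comps S (F \<inter> Pow S)) + card (comps ?T (F \<inter> Pow ?T))"
      using card_comps_split[of F S ?T] F fin W by auto
    show "(case (F \<inter> Pow S, F \<inter> Pow ?T) of (F1, F2) \<Rightarrow>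
        (-1) ^ card F1 * ((-1) ^ card S * (-1) ^ (card F2 + card ?T + card (comps ?T F2)))) =
      ((-1) ^ (card F + card W + card (comps W F) + card (comps S (F \<inter> Pow S))) :: 'a)"
      unfolding cF cW cc by (simp add: power_add algebra_simps flip: power_mult_distrib)
  next
    fix p assume p: "p \<in> Pow (edges_in E S) \<times> Pow (edges_in E ?T)"
    obtain F1 F2 where F: "p = (F1, F2)" "F1 \<subseteq> edges_in E S" "F2 \<subseteq> edges_in E ?T"
      using p by auto
    have sub: "edges_in E S \<subseteq> edges_in E W" "edges_in E ?T \<subseteq> edges_in E W"
      using assms(2) by (auto simp: edges_in_def)
    have P: "F1 \<subseteq> Pow S" "F2 \<subseteq> Pow ?T"
      using order.trans[OF F(2) edges_in_subset_Pow] order.trans[OF F(3) edges_in_subset_Pow]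
      by simp_all
    have "{} \<notin> F1" "{} \<notin> F2"
      using contra_subsetD[OF F(2) empty_notin_edges_in] contra_subsetD[OF F(3) empty_notin_edges_in]
      by simp_all
    then have cross: "F1 \<inter> Pow ?T = {}" "F2 \<inter> Pow S = {}"
      using Int_mono[OF P(1) order.refl, of "Pow ?T"] Int_mono[OF P(2) order.refl, of "Pow S"]
      by (auto simp only: PowT Int_commute[of "Pow ?T"])
    show "(case p of (F1, F2) \<Rightarrow> F1 \<union> F2) \<in> {F. F \<in> Pow (edges_in E W) \<and> F \<subseteq> Pow S \<union> Pow ?T}"
      using F P sub by auto
    have "(F1 \<union> F2) \<inter> Pow S = F1" "(F1 \<union> F2) \<inter> Pow ?T = F2"
      using P cross by (simp_all only: Int_Un_distrib2 Int_absorb2 Un_empty_left Un_empty_right)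
    then show "((case p of (F1, F2) \<Rightarrow> F1 \<union> F2) \<inter> Pow S, (case p of (F1, F2) \<Rightarrow> F1 \<union> F2) \<inter> Pow ?T) = p"
      using F by simp
  qed
  also have "\<dots> = (\<Sum>F\<in>Pow (edges_in E S). (-1) ^ card F) *
      (\<Sum>F\<in>Pow (edges_in E ?T). (-1) ^ card S * (-1) ^ (card F + card ?T + card (comps ?T F)))"
    unfolding sum_product sum.cartesian_product ..
  also have "(\<Sum>F\<in>Pow (edges_in E ?T). (-1) ^ card S * (-1) ^ (card F + card ?T + card (comps ?T F))) =
      (-1) ^ card S * (of_int (edge_set_sum E ?T) :: 'a)"
    by (simp add: edge_set_sum_def sum_distrib_left)
  finally show ?thesis
    by (simp add: sum_Pow_minus_one finite_edges_in fin)
qed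

lemma edge_set_sum_expand:
  fixes x :: "'v \<Rightarrow> 'a :: comm_ring_1"
  assumes "finite W"
  shows "(\<Sum>F\<in>Pow (edges_in E W). (-1) ^ (card F + card W + card (comps W F)) *
      (\<Prod>B\<in>comps W F. 1 - (\<Prod>v\<in>B. x v))) = independent_sum E (edge_set_sum E) W x"
proof -
  let ?s = "\<lambda>F S. (-1) ^ (card F + card W + card (comps W F) + card (comps S (F \<inter> Pow S))) :: 'a"
  have "(\<Sum>F\<in>Pow (edges_in E W). (-1) ^ (card F + card W + card (comps W F)) *
      (\<Prod>B\<in>comps W F. 1 - (\<Prod>v\<in>B. x v))) =
    (\<Sum>F\<in>Pow (edges_in E W). \<Sum>S | S \<in> Pow W \<and> F \<subseteq> Pow S \<union> Pow (W - S). ?s F S * (\<Prod>v\<in>S. x v))"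
    by (intro sum.cong refl)
      (simp add: prod_comps_expand[OF assms] sum_distrib_left power_add mult.assoc)
  \<comment> \<open>Read for fixed \<open>S\<close>, the same condition selects the edge sets summed
    in \<open>sum_separated\<close>.\<close>
  also have "\<dots> = (\<Sum>S\<in>Pow W. \<Sum>F | F \<in> Pow (edges_in E W) \<and> F \<subseteq> Pow S \<union> Pow (W - S).
      ?s F S * (\<Prod>v\<in>S. x v))"
    using assms by (intro sum.swap_restrict) (simp_all add: finite_edges_in)
  also have "\<dots> = (\<Sum>S\<in>Pow W. if edges_in E S = {}
      then (-1) ^ card S * of_int (edge_set_sum E (W - S)) * (\<Prod>v\<in>S. x v) else 0)"
    by (intro sum.cong refl, subst sum_distrib_right[symmetric], subst sum_separated[OF assms]) auto
  also have "\<dots> = independent_sum E (edge_set_sum E) W x"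
    unfolding independent_sum_def using assms by (subst sum.inter_filter) simp_all
  finally show ?thesis .
qed

section \<open>Acyclic orientations\<close>

text \<open>A bare relation on any vertex set \<open>W\<close>, so that sinks can be deleted; its
  sinks are \<open>W - Domain A\<close>.\<close>

definition acyclic_orients :: "'v rel \<Rightarrow> 'v set \<Rightarrow> 'v rel set" where
  "acyclic_orients E W = {A. A \<subseteq> E \<inter> W \<times> W \<and>
     (\<forall>(u, v) \<in> E \<inter> W \<times> W. (u, v) \<in> A \<longleftrightarrow> (v, u) \<notin> A) \<and> acyclic A}"

lemma finite_acyclic_orients: "finite W \<Longrightarrow> finite (acyclic_orients E W)"
  by (rule finite_subset[of _ "Pow (W \<times> W)"]) (auto simp: acyclic_orients_def)

text \<open>Read the path backwards: its last arc ends outside \<open>S\<close>, so it belongs to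
  \<open>A\<close>, and then it also starts outside \<open>S\<close>.\<close>

lemma trancl_Un_avoiding:
  assumes "(x, y) \<in> (A \<union> B)\<^sup>+" "y \<notin> S" "Range B \<subseteq> S" "Domain A \<inter> S = {}"
  shows "(x, y) \<in> A\<^sup>+"
  using assms(1,2)
proof (induction rule: trancl_induct)
  case (base y)
  then show ?case using assms(3) by blast
next
  case (step y z)
  then have "(y, z) \<in> A" "y \<notin> S" using assms(3,4) by blast+
  with step show ?case by (blast intro: trancl_into_trancl)
qed

text \<open>All arcs start outside \<open>S\<close>, so a cycle avoids \<open>S\<close> and is
  already a cycle of \<open>A\<close>.\<close>

lemma acyclic_Un_into_sinks:
  assumes "acyclic A" "Range B \<subseteq> S" "Domain A \<inter> S = {}" "Domain B \<inter> S = {}"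
  shows "acyclic (A \<union> B)"
  unfolding acyclic_def
proof (intro allI notI)
  fix x assume x: "(x, x) \<in> (A \<union> B)\<^sup>+"
  then have "x \<in> Domain (A \<union> B)" by (meson Domain.DomainI tranclD)
  then have "x \<notin> S" using assms by blast
  with trancl_Un_avoiding[OF x] assms show False by (auto simp: acyclic_def)
qed

lemma edges_in_empty_iff: "edges_in E S = {} \<longleftrightarrow> E \<inter> S \<times> S = {}"
  by (auto simp: edges_in_def)

text \<open>Making all of \<open>S\<close> sinks forces the edges between \<open>W - S\<close> and
  \<open>S\<close> to point into \<open>S\<close> (the arcs \<open>?B\<close>) and leaves the rest
  free, since arcs into sinks close no cycle. An edge inside \<open>S\<close> would leave one of its
  ends.\<close>

lemma card_acyclic_orients_sinks:
  assumes "sym E" "S \<subseteq> W"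
  shows "card {A \<in> acyclic_orients E W. S \<subseteq> W - Domain A} =
    (if edges_in E S = {} then card (acyclic_orients E (W - S)) else 0)"
proof (cases "edges_in E S = {}")
  case True
  let ?T = "W - S" and ?B = "E \<inter> (W - S) \<times> S"
  have symE: "(v, u) \<in> E \<longleftrightarrow> (u, v) \<in> E" for u v using assms(1) by (auto dest: symD)
  have ind: "E \<inter> S \<times> S = {}" using True by (simp add: edges_in_empty_iff)
  have "bij_betw (\<lambda>A. A \<inter> ?T \<times> ?T) {A \<in> acyclic_orients E W. S \<subseteq> W - Domain A}
      (acyclic_orients E ?T)"
  proof (rule bij_betw_byWitness[where f' = "\<lambda>A. A \<union> ?B"])
    show "\<forall>A\<in>{A \<in> acyclic_orients E W. S \<subseteq> W - Domain A}. A \<inter> ?T \<times> ?T \<union> ?B = A"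
    proof
      fix A assume "A \<in> {A \<in> acyclic_orients E W. S \<subseteq> W - Domain A}"
      then have A: "A \<subseteq> E \<inter> W \<times> W" "\<forall>(u, v) \<in> E \<inter> W \<times> W. (u, v) \<in> A \<longleftrightarrow> (v, u) \<notin> A"
          "S \<inter> Domain A = {}"
        by (auto simp: acyclic_orients_def)
      have "?B \<subseteq> A" using A assms(2) by fast
      moreover have "A \<subseteq> ?T \<times> ?T \<union> ?B" using A by fast
      ultimately show "A \<inter> ?T \<times> ?T \<union> ?B = A" by blast
    qed
    show "\<forall>A\<in>acyclic_orients E ?T. (A \<union> ?B) \<inter> ?T \<times> ?T = A"
      by (auto simp: acyclic_orients_def)
    show "(\<lambda>A. A \<inter> ?T \<times> ?T) ` {A \<in> acyclic_orients E W. S \<subseteq> W - Domain A} \<subseteq> acyclic_orients E ?T"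
      by (auto simp: acyclic_orients_def intro: acyclic_subset)
    show "(\<lambda>A. A \<union> ?B) ` acyclic_orients E ?T \<subseteq> {A \<in> acyclic_orients E W. S \<subseteq> W - Domain A}"
    proof clarify
      fix A assume "A \<in> acyclic_orients E ?T"
      then have A: "A \<subseteq> E \<inter> ?T \<times> ?T" "acyclic A"
          "\<And>u v. (u, v) \<in> E \<Longrightarrow> u \<in> ?T \<Longrightarrow> v \<in> ?T \<Longrightarrow> (u, v) \<in> A \<longleftrightarrow> (v, u) \<notin> A"
        by (auto simp: acyclic_orients_def)
      have "acyclic (A \<union> ?B)"
        using A by (intro acyclic_Un_into_sinks[where S = S]) auto
      moreover have "(u, v) \<in> A \<union> ?B \<longleftrightarrow> (v, u) \<notin> A \<union> ?B"
        if "(u, v) \<in> E" "u \<in> W" "v \<in> W" for u v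
        using that A(1) A(3)[of u v] ind symE[of u v]
        by (cases "u \<in> S"; cases "v \<in> S") auto
      ultimately show "A \<union> ?B \<in> acyclic_orients E W \<and> S \<subseteq> W - Domain (A \<union> ?B)"
        using A(1) assms(2) unfolding acyclic_orients_def by fast
    qed
  qed
  then show ?thesis using True by (simp add: bij_betw_same_card)
next
  case False
  then obtain u v where uv: "(u, v) \<in> E" "u \<in> S" "v \<in> S" by (auto simp: edges_in_empty_iff)
  have "{A \<in> acyclic_orients E W. S \<subseteq> W - Domain A} = {}"
    using uv assms(2) unfolding acyclic_orients_def by blast
  then show ?thesis using False by (simp only: card.empty if_False)
qed

text \<open>Multiplying out the product over the sinks chooses a set \<open>S\<close> of sinks;
  after exchanging the sums, the orientations with \<open>S\<close> among their sinks are
  counted.\<close>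

lemma acyclic_orients_expand:
  fixes x :: "'v \<Rightarrow> 'a :: comm_ring_1"
  assumes "finite W" "sym E"
  shows "(\<Sum>A\<in>acyclic_orients E W. \<Prod>v\<in>W - Domain A. 1 - x v) =
    independent_sum E (\<lambda>S. int (card (acyclic_orients E S))) W x"
proof -
  let ?t = "\<lambda>S. (-1) ^ card S * (\<Prod>v\<in>S. x v)"
  have "(\<Sum>A\<in>acyclic_orients E W. \<Prod>v\<in>W - Domain A. 1 - x v) =
      (\<Sum>A\<in>acyclic_orients E W. \<Sum>S\<in>Pow (W - Domain A). ?t S)"
    using assms(1) by (simp add: prod_diff_conv_sum)
  also have "\<dots> = (\<Sum>A\<in>acyclic_orients E W. \<Sum>S | S \<in> Pow W \<and> S \<subseteq> W - Domain A. ?t S)"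
    by (intro sum.cong refl) auto
  also have "\<dots> = (\<Sum>S\<in>Pow W. \<Sum>A | A \<in> acyclic_orients E W \<and> S \<subseteq> W - Domain A. ?t S)"
    using assms(1) by (intro sum.swap_restrict) (simp_all add: finite_acyclic_orients)
  also have "\<dots> = (\<Sum>S\<in>Pow W. if edges_in E S = {}
      then (-1) ^ card S * of_int (int (card (acyclic_orients E (W - S)))) * (\<Prod>v\<in>S. x v) else 0)"
    by (intro sum.cong refl) (simp add: card_acyclic_orients_sinks[OF assms(2)] mult_ac)
  also have "\<dots> = independent_sum E (\<lambda>S. int (card (acyclic_orients E S))) W x"
    unfolding independent_sum_def using assms(1) by (subst sum.inter_filter) simp_all
  finally show ?thesis .
qed

lemma acyclic_orients_sink:
  assumes "finite W" "W \<noteq> {}" "A \<in> acyclic_orients E W"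
  shows "W - Domain A \<noteq> {}"
proof -
  have A: "A \<subseteq> W \<times> W" "acyclic A" using assms(3) by (auto simp: acyclic_orients_def)
  \<comment> \<open>A minimal vertex for the converse relation has no outgoing arc.\<close>
  then have "wf (A\<inverse>)"
    using assms(1) by (meson finite_SigmaI finite_acyclic_wf_converse finite_subset)
  then obtain z where "z \<in> W" "\<And>y. (y, z) \<in> A\<inverse> \<Longrightarrow> y \<notin> W"
    using assms(2) by (metis wf_eq_minimal ex_in_conv)
  then have "z \<in> W - Domain A" using A(1) by blast
  then show ?thesis by blast
qed

section \<open>Comparison of the two expansions at x = 1\<close>

text \<open>If \<open>W\<close> is non-empty, every product over sinks has a factor
  \<open>1 - 1\<close>; if it is empty, the empty orientation contributes 1.\<close>

lemma independent_sum_acyclic_orients_1: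
  assumes "finite W" "sym E"
  shows "independent_sum E (\<lambda>S. int (card (acyclic_orients E S))) W (\<lambda>_. 1 :: int) =
    (if W = {} then 1 else 0)"
proof (cases "W = {}")
  case True
  then have "acyclic_orients E W = {{}}" by (auto simp: acyclic_orients_def acyclic_def)
  then show ?thesis
    unfolding acyclic_orients_expand[OF assms, symmetric] using True by simp
next
  case False
  have "(\<Prod>v\<in>W - Domain A. 1 - 1 :: int) = 0" if "A \<in> acyclic_orients E W" for A
    using acyclic_orients_sink[OF assms(1) False that] assms(1) by (simp add: power_0_left)
  then have "(\<Sum>A\<in>acyclic_orients E W. \<Prod>v\<in>W - Domain A. 1 - 1 :: int) = 0"
    by (rule sum.neutral[OF ballI])
  then show ?thesis
    unfolding acyclic_orients_expand[OF assms, symmetric] using False by (simp only: if_False)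
qed

text \<open>A non-empty \<open>W\<close> has a component, and its factor is
  \<open>1 - 1\<close>.\<close>

lemma independent_sum_edge_set_sum_1:
  assumes "finite W"
  shows "independent_sum E (edge_set_sum E) W (\<lambda>_. 1 :: int) = (if W = {} then 1 else 0)"
proof (cases "W = {}")
  case True
  then have "edges_in E W = {}" "comps W {} = {}" by (auto simp: edges_in_def comps_def)
  then show ?thesis
    unfolding edge_set_sum_expand[OF assms, symmetric] using True by simp
next
  case False
  then have "(\<Prod>B\<in>comps W F. 1 - (\<Prod>v\<in>B. 1) :: int) = 0" for F
    using finite_comps[OF assms, of F] by (simp add: comps_def power_0_left)
  then show ?thesis
    unfolding edge_set_sum_expand[OF assms, symmetric] using False
    by (simp only: mult_zero_right sum.neutral_const if_False)
qed

text \<open>The term for the empty \<open>S\<close> is the value at \<open>W\<close> itself, with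
  coefficient 1; all other terms use proper subsets of \<open>W\<close>.\<close>

lemma independent_sum_determines:
  assumes "finite W"
    and "\<And>W. finite W \<Longrightarrow> independent_sum E g W (\<lambda>_. 1 :: int) = independent_sum E h W (\<lambda>_. 1)"
  shows "g W = h W"
  using assms(1)
proof (induction W rule: finite_psubset_induct)
  case (psubset W)
  let ?I = "{S. S \<in> Pow W \<and> edges_in E S = {}}"
  have fin: "finite ?I" and emp: "{} \<in> ?I" using psubset(1) by (auto simp: edges_in_def)
  have split: "independent_sum E f W (\<lambda>_. 1 :: int) =
      f W + (\<Sum>S\<in>?I - {{}}. (-1) ^ card S * f (W - S))" for f
    unfolding independent_sum_def by (subst sum.remove[OF fin emp]) simp
  have "(\<Sum>S\<in>?I - {{}}. (-1) ^ card S * g (W - S)) = (\<Sum>S\<in>?I - {{}}. (-1) ^ card S * h (W - S))"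
    by (intro sum.cong refl arg_cong2[where f = "(*)"] psubset.IH) auto
  then show ?case using assms(2)[OF psubset(1)] split[of g] split[of h] by simp
qed

text \<open>Stanley's theorem on the chromatic polynomial at -1, obtained here from the common
  recursion.\<close>

lemma edge_set_sum_eq_card_acyclic_orients:
  assumes "finite W" "sym E"
  shows "edge_set_sum E W = int (card (acyclic_orients E W))"
  by (rule independent_sum_determines[OF assms(1), where E = E])
    (simp add: independent_sum_acyclic_orients_1[OF _ assms(2)] independent_sum_edge_set_sum_1)


section \<open>From arc relations to orientations of the graph\<close>

text \<open>A pair \<open>(u, u)\<close> in the transitive closure is a non-trivial closed walk, and
  such a walk contains a cycle.\<close>

lemma (in pair_wf_digraph) ex_cycle_iff: "(\<exists>p. cycle p) \<longleftrightarrow> \<not> acyclic (parcs G)"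
proof
  assume "\<exists>p. cycle p"
  then show "\<not> acyclic (parcs G)"
    by (auto simp: cycle_def acyclic_def dest: reachable1_awalkI)
next
  assume "\<not> acyclic (parcs G)"
  then obtain u p where "awalk u p u" "p \<noteq> []"
    by (auto simp: acyclic_def reachable1_awalk)
  then show "\<exists>p. cycle p"
    by (intro closed_w_imp_cycle[of p]) (auto simp: closed_w_def)
qed

lemma acyclic_orientations_iff:
  assumes "pair_graph G"
  shows "D \<in> acyclic_orientations G \<longleftrightarrow>
    pverts D = pverts G \<and> parcs D \<in> acyclic_orients (parcs G) (pverts G)"
proof -
  interpret pair_graph G by fact
  have E: "parcs G \<inter> pverts G \<times> pverts G = parcs G"
    by (auto dest: wellformed')
  show ?thesis
  proof (cases "D \<in> orientations G")
    case True
    \<comment> \<open>The arcs of an orientation are arcs of \<open>G\<close>, so their ends are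
      vertices and the cycle criterion applies.\<close>
    then have "pair_wf_digraph D"
      by unfold_locales
        (use in_arcsD1 in_arcsD2 in \<open>fastforce simp: orientations_def\<close>)+
    then show ?thesis
      using True pair_wf_digraph.ex_cycle_iff[of D]
      by (auto simp: acyclic_orientations_def orientations_def acyclic_orients_def E)
  next
    case False
    then show ?thesis
      by (auto simp: acyclic_orientations_def orientations_def acyclic_orients_def E)
  qed
qed

text \<open>Without loops, an arc starting at \<open>v\<close> ends elsewhere and so violates the
  condition in \<open>sinks\<close>.\<close>

lemma sinks_eq_Diff_Domain:
  assumes "pair_graph G" "D \<in> acyclic_orientations G"
  shows "sinks D = pverts G - Domain (parcs D)"
proof -
  interpret pair_graph G by fact
  have "fst e \<noteq> snd e" if "e \<in> parcs D" for e
    using that assms(2) pair_no_loops by (auto simp: acyclic_orientations_def orientations_def)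
  moreover have "pverts D = pverts G"
    using assms(2) by (simp add: acyclic_orientations_def orientations_def)
  ultimately show ?thesis
    by (fastforce simp: sinks_def)
qed

lemma acyclic_orientation_poly_eq:
  assumes "pair_graph G"
  shows "acyclic_orientation_poly G =
    (\<Sum>A\<in>acyclic_orients (parcs G) (pverts G). \<Prod>v\<in>pverts G - Domain A. Var v)"
  unfolding acyclic_orientation_poly_def
  by (rule sum.reindex_bij_witness[where j = parcs and i = "\<lambda>A. \<lparr>pverts = pverts G, parcs = A\<rparr>"])
    (auto simp: acyclic_orientations_iff[OF assms] sinks_eq_Diff_Domain[OF assms])

section \<open>Whitney's formula for the Moebius function\<close>

text \<open>A walk along \<open>F\<close> stays in its component and uses only edges of the induced
  subgraph, so it witnesses connectedness there.\<close>

lemma (in pair_graph) comps_in_bonds: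
  assumes "F \<subseteq> edges_in (parcs G) (pverts G)"
  shows "comps (pverts G) F \<in> bonds G"
proof -
  have "Digraph_Component.connected (with_proj G \<restriction> (linked F `` {v}))" for v
  proof -
    let ?B = "linked F `` {v}" and ?H = "mk_symmetric (with_proj G \<restriction> (linked F `` {v}))"
    have arc: "(a, b) \<in> parcs ?H" if "a \<in> ?B" "b \<in> ?B" "{a, b} \<in> F" for a b
      using that assms by (fastforce simp: mk_symmetric_def edges_in_def doubleton_eq_iff)
    have "(a, b) \<in> rtrancl_on ?B (parcs ?H)" if "(a, b) \<in> linked F" "a \<in> ?B" for a b
      using that unfolding linked_def
    proof (induction rule: rtrancl_induct)
      case (step y z)
      then have "y \<in> ?B" "z \<in> ?B" "{y, z} \<in> F"
        unfolding linked_def by (auto intro: rtrancl_trans rtrancl_into_rtrancl)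
      then show ?case
        using step arc[of y z] unfolding linked_def by (blast intro: rtrancl_on_into_rtrancl_on)
    qed (simp add: linked_def)
    moreover have "(a, b) \<in> linked F" if "a \<in> ?B" "b \<in> ?B" for a b
      using that equiv_linked[of F] unfolding equiv_def by (blast dest: symD transD)
    moreover have "v \<in> ?B" by (simp add: linked_def)
    ultimately show ?thesis
      unfolding Digraph_Component.connected_def strongly_connected_def reachable_def
      by (auto simp: mk_symmetric_def)
  qed
  then show ?thesis
    using partition_on_comps[OF order.trans[OF assms edges_in_subset_Pow]]
    by (auto simp: bonds_def comps_def)
qed

text \<open>A component cannot leave a block once no edge of \<open>F\<close> joins two blocks.
  Hence the edge sets below a bond form a full power set, over which signs cancel.\<close>

lemma refines_comps_iff:
  assumes "F \<subseteq> edges_in E W" "partition_on W P"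
  shows "refines W (comps W F) P \<longleftrightarrow> F \<subseteq> (\<Union>B\<in>P. edges_in E B)"
proof
  assume ref: "refines W (comps W F) P"
  show "F \<subseteq> (\<Union>B\<in>P. edges_in E B)"
  proof
    fix e assume e: "e \<in> F"
    then obtain u v where uv: "e = {u, v}" "(u, v) \<in> E" "u \<in> W"
      using assms(1) by (auto simp: edges_in_def)
    then have "v \<in> linked F `` {u}" using e linked_edge by fast
    moreover have "u \<in> linked F `` {u}" by (simp add: linked_def)
    moreover obtain B where "B \<in> P" "linked F `` {u} \<subseteq> B"
      using ref uv(3) by (auto simp: refines_def comps_def)
    ultimately have "e \<in> edges_in E B" using uv by (auto simp: edges_in_def)
    then show "e \<in> (\<Union>B\<in>P. edges_in E B)" using \<open>B \<in> P\<close> by blast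
  qed
next
  assume F: "F \<subseteq> (\<Union>B\<in>P. edges_in E B)"
  have FW: "F \<subseteq> Pow W" using assms(1) edges_in_subset_Pow by blast
  have "\<exists>B\<in>P. linked F `` {v} \<subseteq> B" if v: "v \<in> W" for v
  proof -
    obtain B where B: "B \<in> P" "v \<in> B" using assms(2) v by (auto simp: partition_on_def)
    have "F \<subseteq> Pow B \<union> Pow (W - B)"
    proof
      fix e assume e: "e \<in> F"
      then obtain C where C: "C \<in> P" "e \<subseteq> C" using F edges_in_subset_Pow by blast
      then have "C = B \<or> C \<inter> B = {}"
        using partition_onD2[OF assms(2)] B(1) by (auto dest: disjointD)
      then show "e \<in> Pow B \<union> Pow (W - B)" using C e FW by blast
    qed
    then show ?thesis using B linked_restrict[of v _ F B "W - B"] by blast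
  qed
  then show "refines W (comps W F) P"
    using assms(2) partition_on_comps[OF FW] by (auto simp: refines_def comps_def)
qed

text \<open>Reachability without arcs is equality, so a connected block without edges has a single
  vertex.\<close>

lemma (in pair_graph) bond_without_edges:
  assumes "\<pi> \<in> bonds G" "(\<Union>B\<in>\<pi>. edges_in (parcs G) B) = {}"
  shows "\<pi> = bot_bond G"
proof -
  have single: "B = {v}" if "B \<in> \<pi>" "v \<in> B" for B v
  proof -
    let ?H = "mk_symmetric (with_proj G \<restriction> B)"
    have "edges_in (parcs G) B = {}" using assms(2) that by auto
    then have no: "parcs ?H = {}"
      by (auto simp: mk_symmetric_def edges_in_empty_iff)
    have "(v, w) \<in> rtrancl_on B (parcs ?H)" if "w \<in> B" for w
      using assms(1) \<open>B \<in> \<pi>\<close> \<open>v \<in> B\<close> that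
      by (auto simp: bonds_def Digraph_Component.connected_def strongly_connected_def
          reachable_def mk_symmetric_def)
    then have "w = v" if "w \<in> B" for w
      using that rtrancl_on_rtranclI[of v w B "{}"] unfolding no by simp
    then show ?thesis using \<open>v \<in> B\<close> by blast
  qed
  have part: "partition_on (pverts G) \<pi>" using assms(1) by (simp add: bonds_def)
  show ?thesis
  proof
    show "\<pi> \<subseteq> bot_bond G"
    proof
      fix B assume B: "B \<in> \<pi>"
      then obtain v where "v \<in> B" using partition_onD3[OF part] by (metis ex_in_conv)
      then show "B \<in> bot_bond G"
        using B single[OF B] partition_onD1[OF part] unfolding bot_bond_def by blast
    qed
    show "bot_bond G \<subseteq> \<pi>"
    proof
      fix B assume "B \<in> bot_bond G"
      then obtain v where v: "v \<in> pverts G" "B = {v}" by (auto simp: bot_bond_def)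
      then obtain C where "C \<in> \<pi>" "v \<in> C" using partition_onD1[OF part] by blast
      then show "B \<in> \<pi>" using single v(2) by metis
    qed
  qed
qed

text \<open>The defining recursion of the Moebius function, for Whitney's sums. Ungrouping them
  gives the alternating sum over all sets of edges inside the blocks.\<close>

lemma (in pair_graph) sum_edge_sets_below:
  assumes "\<pi> \<in> bonds G"
  shows "(\<Sum>\<tau> | \<tau> \<in> bonds G \<and> refines (pverts G) \<tau> \<pi>.
      \<Sum>F | F \<in> Pow (edges_in (parcs G) (pverts G)) \<and> comps (pverts G) F = \<tau>. (-1) ^ card F) =
    (if \<pi> = bot_bond G then 1 else 0 :: int)"
proof -
  let ?V = "pverts G" and ?E = "parcs G"
  let ?EP = "\<Union>B\<in>\<pi>. edges_in ?E B"
  let ?X = "{F. F \<in> Pow (edges_in ?E ?V) \<and> refines ?V (comps ?V F) \<pi>}"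
  have part: "partition_on ?V \<pi>" using assms by (simp add: bonds_def)
  have sub: "?EP \<subseteq> edges_in ?E ?V"
  proof (rule UN_least)
    fix B assume "B \<in> \<pi>"
    then have "B \<subseteq> ?V" using partition_onD1[OF part] by blast
    then show "edges_in ?E B \<subseteq> edges_in ?E ?V" by (auto simp: edges_in_def)
  qed
  have X: "?X = Pow ?EP"
  proof (rule set_eqI)
    fix F
    show "F \<in> ?X \<longleftrightarrow> F \<in> Pow ?EP"
    proof (cases "F \<subseteq> edges_in ?E ?V")
      case True
      then show ?thesis by (simp only: mem_Collect_eq Pow_iff refines_comps_iff[OF True part] simp_thms)
    next
      case False
      then have "\<not> F \<subseteq> ?EP" using order.trans[OF _ sub, of F] by fast
      with False show ?thesis by (simp only: mem_Collect_eq Pow_iff simp_thms)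
    qed
  qed
  have fin: "finite (edges_in ?E ?V)" by (simp add: finite_edges_in)
  have finEP: "finite ?EP"
    using sub fin by (rule finite_subset)
  have "(\<Sum>\<tau> | \<tau> \<in> bonds G \<and> refines ?V \<tau> \<pi>.
      \<Sum>F | F \<in> Pow (edges_in ?E ?V) \<and> comps ?V F = \<tau>. (-1) ^ card F) =
    (\<Sum>\<tau> | \<tau> \<in> bonds G \<and> refines ?V \<tau> \<pi>. \<Sum>F | F \<in> ?X \<and> comps ?V F = \<tau>. (-1) ^ card F :: int)"
    by (intro sum.cong refl) auto
  also have "\<dots> = (\<Sum>F\<in>?X. (-1) ^ card F)"
    by (rule sum.group) (use fin comps_in_bonds in \<open>auto simp: finite_bonds\<close>)
  also have "\<dots> = (if ?EP = {} then 1 else 0)"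
    unfolding X by (rule sum_Pow_minus_one[OF finEP])
  also have "?EP = {} \<longleftrightarrow> \<pi> = bot_bond G"
  proof
    assume "?EP = {}"
    then show "\<pi> = bot_bond G" by (rule bond_without_edges[OF assms])
  next
    assume "\<pi> = bot_bond G"
    then show "?EP = {}"
      using pair_no_loops by (force simp: bot_bond_def edges_in_empty_iff)
  qed
  finally show ?thesis .
qed

lemma bond_moebius_bot_eq:
  assumes "pair_graph G" "\<pi> \<in> bonds G"
  shows "bond_moebius G (bot_bond G) \<pi> =
    (\<Sum>F | F \<in> Pow (edges_in (parcs G) (pverts G)) \<and> comps (pverts G) F = \<pi>. (-1) ^ card F)"
  using assms
proof (induction G "bot_bond G" \<pi> rule: bond_moebius.induct)
  case (1 G \<pi>)
  interpret pair_graph G by fact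
  let ?f = "\<lambda>\<tau>. \<Sum>F | F \<in> Pow (edges_in (parcs G) (pverts G)) \<and> comps (pverts G) F = \<tau>.
    (-1) ^ card F :: int"
  let ?less = "{\<tau> \<in> bonds G. refines (pverts G) (bot_bond G) \<tau> \<and> refines (pverts G) \<tau> \<pi> \<and> \<tau> \<noteq> \<pi>}"
  note bot = bot_bond_in_bonds[OF 1(2)] and le = bot_bond_least[OF 1(2)]
  \<comment> \<open>As \<open>bot_bond G\<close> is least, the interval from it to
    \<open>\<pi>\<close> consists of all bonds that refine \<open>\<pi>\<close>.\<close>
  have eq: "{\<tau>. \<tau> \<in> bonds G \<and> refines (pverts G) \<tau> \<pi>} = insert \<pi> ?less"
  proof (intro subset_antisym subsetI)
    fix \<tau> assume "\<tau> \<in> insert \<pi> ?less"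
    moreover have "refines (pverts G) \<pi> \<pi>" using 1(3) by (simp add: bonds_def refines_refl)
    ultimately show "\<tau> \<in> {\<tau>. \<tau> \<in> bonds G \<and> refines (pverts G) \<tau> \<pi>}" using 1(3) by blast
  qed (use le in blast)
  have "finite ?less" by (simp add: finite_bonds)
  then have sum: "?f \<pi> + (\<Sum>\<tau>\<in>?less. ?f \<tau>) = (if \<pi> = bot_bond G then 1 else 0)"
    using sum_edge_sets_below[OF 1(3)] unfolding eq by (subst (asm) sum.insert) simp_all
  show ?case
  proof (cases "\<pi> = bot_bond G")
    case True
    then have "?less = {}"
      using refines_asym by blast
    then have "?f \<pi> = 1"
      using sum by (simp only: True sum.empty add_0_right if_True refl)
    then show ?thesis
      using bond_moebius_refl[OF 1(2) bot] True by simp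
  next
    case False
    have "(\<Sum>\<tau>\<in>?less. bond_moebius G (bot_bond G) \<tau>) = (\<Sum>\<tau>\<in>?less. ?f \<tau>)"
    proof (intro sum.cong refl)
      fix \<tau> assume \<tau>: "\<tau> \<in> ?less"
      have "finite (pverts G) \<and> bot_bond G \<in> bonds G \<and> \<pi> \<in> bonds G \<and>
          refines (pverts G) (bot_bond G) \<pi>"
        using bot 1(3) le[OF 1(3)] by simp
      from 1(1)[OF this False[symmetric] \<tau> 1(2)] \<tau>
      show "bond_moebius G (bot_bond G) \<tau> = ?f \<tau>" by simp
    qed
    then have "bond_moebius G (bot_bond G) \<pi> = - (\<Sum>\<tau>\<in>?less. ?f \<tau>)"
      using bond_moebius_less[OF 1(2) bot 1(3) le[OF 1(3)]] False by metis
    then show ?thesis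
      using sum False by (simp only: if_False add_eq_0_iff2)
  qed
qed

section \<open>Summation over the bond lattice\<close>

theorem theorem3p10:
  fixes G :: "'v pair_pre_digraph" and d :: nat
  assumes "pair_graph G" and "d = card (pverts G)"
  shows "acyclic_orientation_poly G =
    (\<Sum>\<pi> \<in> bonds G. (-1) ^ (d - card \<pi>) * of_int (bond_moebius G (bot_bond G) \<pi>) *
       (\<Prod>B \<in> \<pi>. block_poly B))"
proof -
  interpret pair_graph G by fact
  let ?V = "pverts G" and ?E = "parcs G"
  let ?X = "Pow (edges_in ?E ?V)"
  \<comment> \<open>With this substitution \<open>Var v\<close> is \<open>1 - ?x v\<close>, and
    \<open>block_poly B\<close> is 1 minus the product of \<open>?x\<close> over \<open>B\<close>,
    as in the two expansions.\<close>
  let ?x = "\<lambda>v. 1 - Var v :: 'v int_mpoly"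
  have sym: "sym ?E" using pair_sym_arcs by (simp add: symmetric_def)
  have indep: "independent_sum ?E (\<lambda>S. int (card (acyclic_orients ?E S))) ?V ?x =
      independent_sum ?E (edge_set_sum ?E) ?V ?x"
    unfolding independent_sum_def
    by (intro sum.cong refl)
      (simp add: edge_set_sum_eq_card_acyclic_orients[OF _ sym])
  \<comment> \<open>Natural subtraction truncates, but \<open>card \<pi> \<le> d\<close>, so both
    exponents have the same parity.\<close>
  have sign: "(-1 :: 'v int_mpoly) ^ (d - card \<pi>) = (-1) ^ (d + card \<pi>)" if "\<pi> \<in> bonds G" for \<pi>
  proof -
    have "partition_on ?V \<pi>" using that by (simp add: bonds_def)
    then have "card \<pi> \<le> d"
      unfolding assms(2) by (intro card_partition_on_le) simp_all
    then have "even (d - card \<pi>) = even (d + card \<pi>)" by simp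
    then show ?thesis by (simp only: minus_one_power_iff)
  qed
  have "acyclic_orientation_poly G =
      (\<Sum>A\<in>acyclic_orients ?E ?V. \<Prod>v\<in>?V - Domain A. 1 - ?x v)"
    by (simp add: acyclic_orientation_poly_eq[OF assms(1)])
  also have "\<dots> = independent_sum ?E (edge_set_sum ?E) ?V ?x"
    unfolding indep[symmetric] by (rule acyclic_orients_expand) (simp_all add: sym)
  also have "\<dots> = (\<Sum>F\<in>?X. (-1) ^ (card F + d + card (comps ?V F)) *
      (\<Prod>B\<in>comps ?V F. block_poly B))"
    unfolding block_poly_def assms(2) by (rule edge_set_sum_expand[symmetric]) simp
  \<comment> \<open>Group the edge sets by the bond of their components: apart from
    \<open>(-1) ^ card F\<close>, each term depends on this bond only, which leaves Whitney's
    sum.\<close>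
  also have "\<dots> = (\<Sum>\<pi>\<in>bonds G. \<Sum>F | F \<in> ?X \<and> comps ?V F = \<pi>.
      (-1) ^ (card F + d + card (comps ?V F)) * (\<Prod>B\<in>comps ?V F. block_poly B))"
    by (rule sum.group[symmetric])
      (use comps_in_bonds in \<open>auto simp: finite_bonds finite_edges_in\<close>)
  also have "\<dots> = (\<Sum>\<pi>\<in>bonds G. (-1) ^ (d - card \<pi>) * of_int (bond_moebius G (bot_bond G) \<pi>) *
       (\<Prod>B\<in>\<pi>. block_poly B))"
  proof (intro sum.cong refl)
    fix \<pi> assume \<pi>: "\<pi> \<in> bonds G"
    have "(\<Sum>F | F \<in> ?X \<and> comps ?V F = \<pi>.
        (-1) ^ (card F + d + card (comps ?V F)) * (\<Prod>B\<in>comps ?V F. block_poly B)) =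
      (\<Sum>F | F \<in> ?X \<and> comps ?V F = \<pi>.
        (-1) ^ (d + card \<pi>) * (-1) ^ card F * (\<Prod>B\<in>\<pi>. block_poly B))"
      by (intro sum.cong refl) (auto simp: power_add mult_ac)
    also have "\<dots> = (-1) ^ (d + card \<pi>) * of_int (bond_moebius G (bot_bond G) \<pi>) *
        (\<Prod>B\<in>\<pi>. block_poly B)"
      by (simp add: bond_moebius_bot_eq[OF assms(1) \<pi>] sum_distrib_left sum_distrib_right)
    finally show "(\<Sum>F | F \<in> ?X \<and> comps ?V F = \<pi>.
        (-1) ^ (card F + d + card (comps ?V F)) * (\<Prod>B\<in>comps ?V F. block_poly B)) =
      (-1) ^ (d - card \<pi>) * of_int (bond_moebius G (bot_bond G) \<pi>) * (\<Prod>B\<in>\<pi>. block_poly B)"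
      by (simp add: sign[OF \<pi>])
  qed
  finally show ?thesis .
qed

end
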